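(* Let $\langle X,\mathscr{O}\rangle$ be a topological space and consider its topological contact algebra $\langle\mathrm{RO}(X),\mathsf{C}_{\mathrm{T}}\rangle$. If $A$ is an abstractive set in $\langle\mathrm{RO}(X),\mathsf{C}_{\mathrm{T}}\rangle$ that is at the same time a local basis at a point $p\in X$, then $A$ is a W-representative.
   Context: $\mathrm{RO}(X)$ is the Boolean algebra of regular open subsets of $X$ with $x\cdot y=x\cap y$, $x+y=\mathrm{Int}\,\mathrm{Cl}(x\cup y)$, $-x=\mathrm{Int}(X\setminus x)$; contact: $x\mathrel{\mathsf{C}_{\mathrm{T}}} y$ iff $\mathrm{Cl}\,x\cap\mathrm{Cl}\,y\neq\emptyset$; $x\ll y$ means $\neg(x\mathrel{\mathsf{C}_{\mathrm{T}}}-y)$, equivalently $\mathrm{Cl}\,x\subseteq y$. An abstractive set is a set $A$ of regions with (r0) $\emptyset\notin A$; (r1) for all $u,v\in A$: $u=v$ or $u\ll v$ or $v\ll u$; (A) $A$ has no non-zero lower bound, i.e., there is no non-empty $x\in\mathrm{RO}(X)$ with $x\subseteq y$ for all $y\in A$. For sets of regions, $B\trianglelefteq A$ means: for every $a\in A$ there is $b\in B$ with $b\subseteq a$. An abstractive set $A$ is a W-representative iff for every abstractive set $B$, $B\trianglelefteq A$ implies $A\trianglelefteq B$. *)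

theory Defs
  imports "HOL-Analysis.Analysis"
begin

definition regular_open :: "'a topology \<Rightarrow> 'a set set" where
  "regular_open X = {x. x \<subseteq> topspace X \<and> X interior_of (X closure_of x) = x}"

(* The order of the Boolean algebra regular_open X is set inclusion and its zero is the empty
   set, so of its operations only the complement needs a name here. *)
definition ro_compl :: "'a topology \<Rightarrow> 'a set \<Rightarrow> 'a set" where
  "ro_compl X x = X interior_of (topspace X - x)"

definition contact :: "'a topology \<Rightarrow> 'a set \<Rightarrow> 'a set \<Rightarrow> bool" where
  "contact X x y \<longleftrightarrow> X closure_of x \<inter> X closure_of y \<noteq> {}"

definition well_inside :: "'a topology \<Rightarrow> 'a set \<Rightarrow> 'a set \<Rightarrow> bool" where
  "well_inside X x y \<longleftrightarrow> \<not> contact X x (ro_compl X y)"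

lemma well_inside_iff_closure_subset:
  assumes "x \<in> regular_open X" and "y \<in> regular_open X"
  shows "well_inside X x y \<longleftrightarrow> X closure_of x \<subseteq> y"
proof -
  have y: "X interior_of (X closure_of y) = y" and yt: "y \<subseteq> topspace X"
    using assms(2) by (auto simp: regular_open_def)
  have "X closure_of (ro_compl X y) = topspace X - X interior_of (X closure_of y)"
    by (simp add: ro_compl_def interior_of_complement closure_of_complement)
  then have "X closure_of (ro_compl X y) = topspace X - y"
    using y by simp
  then show ?thesis
    using closure_of_subset_topspace[of X x] by (auto simp: well_inside_def contact_def)
qed

definition abstractive_set :: "'a topology \<Rightarrow> 'a set set \<Rightarrow> bool" where
  "abstractive_set X A \<longleftrightarrow>
     A \<subseteq> regular_open X \<and>
     {} \<notin> A \<and>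
     (\<forall>u\<in>A. \<forall>v\<in>A. u = v \<or> well_inside X u v \<or> well_inside X v u) \<and>
     \<not> (\<exists>x\<in>regular_open X. x \<noteq> {} \<and> (\<forall>y\<in>A. x \<subseteq> y))"

definition covered_by :: "'a set set \<Rightarrow> 'a set set \<Rightarrow> bool"  (infix \<open>\<unlhd>\<close> 50) where
  "B \<unlhd> A \<longleftrightarrow> (\<forall>a\<in>A. \<exists>b\<in>B. b \<subseteq> a)"

definition W_representative :: "'a topology \<Rightarrow> 'a set set \<Rightarrow> bool" where
  "W_representative X A \<longleftrightarrow>
     abstractive_set X A \<and> (\<forall>B. abstractive_set X B \<longrightarrow> B \<unlhd> A \<longrightarrow> A \<unlhd> B)"

(* neighbourhood_base_at does not require every member of the family to be a neighbourhood
   of p, so this is added. *)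
definition local_basis_at :: "'a topology \<Rightarrow> 'a \<Rightarrow> 'a set set \<Rightarrow> bool" where
  "local_basis_at X p A \<longleftrightarrow>
     (\<forall>U\<in>A. openin X U \<and> p \<in> U) \<and> neighbourhood_base_at p (\<lambda>U. U \<in> A) X"

end

theory Submission
  imports Defs
begin

text \<open>Let \<open>b\<close> belong to an abstractive set \<open>B\<close> with \<open>B \<unlhd> A\<close>. If \<open>p \<in> b\<close>, the local basis \<open>A\<close> has a
  member inside \<open>b\<close>. Otherwise, since \<open>B\<close> has no least element, some \<open>c \<in> B\<close> has its closure inside
  \<open>b\<close>, so the complement of that closure is a neighbourhood of \<open>p\<close>. It contains a member of \<open>A\<close> and
  therefore a member of \<open>B\<close>, which is disjoint from \<open>c\<close>, although any two members of \<open>B\<close> are nested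
  and non-empty.\<close>

lemma regular_open_imp_openin: "x \<in> regular_open X \<Longrightarrow> openin X x"
  using openin_interior_of[of X "X closure_of x"] by (simp add: regular_open_def)

text \<open>A region lies in its own closure, which \<open>well_inside\<close> places inside
  \<open>y\<close>.\<close>

lemma well_inside_imp_subset:
  assumes "x \<in> regular_open X" "y \<in> regular_open X" "well_inside X x y"
  shows "x \<subseteq> y"
  using assms well_inside_iff_closure_subset[OF assms(1,2)] closure_of_subset[of x X]
  by (auto simp: regular_open_def)

lemma abstractive_set_nested:
  assumes "abstractive_set X B" "u \<in> B" "v \<in> B"
  shows "u \<subseteq> v \<or> v \<subseteq> u"
proof -
  have "u \<in> regular_open X" "v \<in> regular_open X" "u = v \<or> well_inside X u v \<or> well_inside X v u"
    using assms by (auto simp: abstractive_set_def)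
  then show ?thesis
    using well_inside_imp_subset by blast
qed

text \<open>If \<open>b\<close> were contained in every member of \<open>B\<close>, it would be a
  non-zero lower bound of \<open>B\<close>.\<close>

lemma abstractive_set_closure_subset:
  assumes B: "abstractive_set X B" and b: "b \<in> B"
  obtains c where "c \<in> B" "X closure_of c \<subseteq> b"
proof -
  have reg: "B \<subseteq> regular_open X" and ne: "b \<noteq> {}"
    using B b by (auto simp: abstractive_set_def)
  have comparable: "b = c \<or> well_inside X b c \<or> well_inside X c b" if "c \<in> B" for c
    using B b that by (auto simp: abstractive_set_def)
  have "\<not> (\<forall>c\<in>B. b \<subseteq> c)"
  proof
    assume "\<forall>c\<in>B. b \<subseteq> c"
    then have "\<exists>x\<in>regular_open X. x \<noteq> {} \<and> (\<forall>y\<in>B. x \<subseteq> y)"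
      using reg ne b by (intro bexI[of _ b]) auto
    then show False
      using B by (simp add: abstractive_set_def)
  qed
  then obtain c where c: "c \<in> B" "\<not> b \<subseteq> c"
    by blast
  \<comment> \<open>Both \<open>b = c\<close> and \<open>well_inside X b c\<close> would give
    \<open>b \<subseteq> c\<close>, so only one alternative is left.\<close>
  then have "well_inside X c b"
    using comparable[OF c(1)] well_inside_imp_subset[of b X c] reg b by auto
  then have "X closure_of c \<subseteq> b"
    using reg b c well_inside_iff_closure_subset by blast
  with c show thesis
    using that by blast
qed

lemma local_basis_at_subset:
  assumes "local_basis_at X p A" "openin X U" "p \<in> U"
  obtains a where "a \<in> A" "a \<subseteq> U"
proof -
  have "neighbourhood_base_at p (\<lambda>U. U \<in> A) X"
    using assms(1) by (simp add: local_basis_at_def)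
  then obtain V W where "V \<in> A" "W \<subseteq> V" "V \<subseteq> U"
    using assms(2,3) unfolding neighbourhood_base_at_def by blast
  then show thesis
    using that by blast
qed

theorem theorem3p3:
  fixes X :: "'a topology" and A :: "'a set set" and p :: 'a
  assumes "p \<in> topspace X"
    and "abstractive_set X A"
    and "local_basis_at X p A"
  shows "W_representative X A"
  unfolding W_representative_def
proof (intro conjI allI impI assms(2))
  fix B
  assume B: "abstractive_set X B" and BA: "B \<unlhd> A"
  have reg: "B \<subseteq> regular_open X" and ne: "{} \<notin> B"
    using B by (auto simp: abstractive_set_def)
  show "A \<unlhd> B"
    unfolding covered_by_def
  proof
    fix b
    assume b: "b \<in> B"
    have "p \<in> b"
    proof (rule ccontr)
      assume "p \<notin> b"
      obtain c where c: "c \<in> B" "X closure_of c \<subseteq> b"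
        using abstractive_set_closure_subset[OF B b] .
      \<comment> \<open>The whole closure of \<open>c\<close> lies in \<open>b\<close>, so it misses
        \<open>p\<close>; \<open>c \<subseteq> b\<close> alone would not ensure this.\<close>
      have "openin X (topspace X - X closure_of c)" "p \<in> topspace X - X closure_of c"
        using assms(1) c \<open>p \<notin> b\<close> by auto
      then obtain a where a: "a \<in> A" "a \<subseteq> topspace X - X closure_of c"
        using local_basis_at_subset[OF assms(3)] by blast
      then obtain d where d: "d \<in> B" "d \<subseteq> a"
        using BA unfolding covered_by_def by blast
      have "c \<subseteq> X closure_of c"
        using reg c by (intro closure_of_subset) (auto simp: regular_open_def)
      then have "d \<inter> c = {}"
        using a d by blast
      \<comment> \<open>By nesting, \<open>d \<inter> c\<close> is the smaller of the two sets, so a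
        member of \<open>B\<close> would be empty.\<close>
      then show False
        using abstractive_set_nested[OF B d(1) c(1)] c(1) d(1) ne by (auto simp: Int_absorb1 Int_absorb2)
    qed
    moreover have "openin X b"
      using b reg regular_open_imp_openin by blast
    ultimately show "\<exists>a\<in>A. a \<subseteq> b"
      using local_basis_at_subset[OF assms(3)] by blast
  qed
qed

end
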